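(* Let $B$ be a cubic graph. For a vertex $v$ of $B$ and $\ell\in\{13,14,15,16\}$, let $c^{\ell}_{\min}(v)$ be the minimum, over the three edges at $v$, of the number of $\ell$-cycles of $B$ containing that edge, and let $N_\ell(B)$ be the number of $\ell$-cycles of $B$. If $$\sum_{v\in V(B)} c^{\ell}_{\min}(v)>(3\ell-33)\,N_\ell(B)$$ for some $\ell\in\{13,14,15,16\}$, then no orientation of the $H_{15}$-replacement of $B$ avoids $64$-cycles; that is, for every orientation the resulting graph contains a cycle of length $64$.
   Context: Graphs are finite, simple and undirected; cycles are simple (and counted as subgraphs). Gadgets: $H_7$ is the graph with vertices $u,v,w,a,b,c,d$ and edges $va,ab,bw,cv,wd,ac,cu,ud,db$. $H_{15}$ consists of two disjoint copies $A,B$ of $H_7$ (with vertices subscripted by $A$ or $B$) and one further vertex $z$, with the additional edges $v_Av_B$, $w_Az$, $zw_B$; its three attachments (its vertices of degree $2$) are named $u=z$, $v=u_B$, $w=u_A$. The $H_{15}$-replacement of a cubic graph: take disjoint copies of $H_{15}$, one for each vertex $x$; for each $x$ choose a bijection between the three edges at $x$ and the three attachments of its copy; for each edge $xy$ add an edge joining the attachment of the copy of $x$ assigned to $xy$ to the attachment of the copy of $y$ assigned to $xy$. An orientation is the choice, for each vertex $x$, of which incident edge is assigned to the attachment $u$ (the order in which the other two edges are assigned to $v$ and $w$ does not affect the isomorphism type, as $H_{15}$ has an automorphism fixing $u$ and exchanging $v$ and $w$). *)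

theory Defs
  imports Main
begin

section \<open>Finite simple graphs and their cycles\<close>

type_synonym 'a graph = "'a set \<times> 'a set set"

abbreviation verts :: "'a graph \<Rightarrow> 'a set" where
  "verts \<equiv> fst"

abbreviation edges :: "'a graph \<Rightarrow> 'a set set" where
  "edges \<equiv> snd"

definition simple_graph :: "'a graph \<Rightarrow> bool" where
  "simple_graph G \<longleftrightarrow> finite (verts G) \<and> (\<forall>e\<in>edges G. e \<subseteq> verts G \<and> card e = 2)"

definition incident :: "'a graph \<Rightarrow> 'a \<Rightarrow> 'a set set" where
  "incident G x = {e \<in> edges G. x \<in> e}"

definition cubic_graph :: "'a graph \<Rightarrow> bool" where
  "cubic_graph G \<longleftrightarrow> simple_graph G \<and> (\<forall>x\<in>verts G. card (incident G x) = 3)"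

definition subgraph :: "'a graph \<Rightarrow> 'a graph \<Rightarrow> bool" where
  "subgraph H G \<longleftrightarrow> verts H \<subseteq> verts G \<and> edges H \<subseteq> edges G"

definition is_cycle :: "nat \<Rightarrow> 'a graph \<Rightarrow> bool" where
  "is_cycle l C \<longleftrightarrow> 3 \<le> l \<and>
     (\<exists>p. distinct p \<and> length p = l \<and>
          C = (set p, {{p ! i, p ! (Suc i mod l)} | i. i < l}))"

text \<open>Cycles are subgraphs, not vertex sequences: rotating or reversing the sequence does not
  give a new cycle.\<close>

definition cycles :: "'a graph \<Rightarrow> nat \<Rightarrow> 'a graph set" where
  "cycles G l = {C. is_cycle l C \<and> subgraph C G}"

definition num_cycles :: "'a graph \<Rightarrow> nat \<Rightarrow> nat" where
  "num_cycles G l = card (cycles G l)"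

definition num_cycles_through :: "'a graph \<Rightarrow> nat \<Rightarrow> 'a set \<Rightarrow> nat" where
  "num_cycles_through G l e = card {C \<in> cycles G l. e \<in> edges C}"

definition c_min :: "'a graph \<Rightarrow> nat \<Rightarrow> 'a \<Rightarrow> nat" where
  "c_min G l x = Min (num_cycles_through G l ` incident G x)"


section \<open>The gadgets\<close>

datatype h7 = H7_u | H7_v | H7_w | H7_a | H7_b | H7_c | H7_d

definition H7 :: "h7 graph" where
  "H7 = (UNIV,
     {{H7_v, H7_a}, {H7_a, H7_b}, {H7_b, H7_w}, {H7_c, H7_v}, {H7_w, H7_d},
      {H7_a, H7_c}, {H7_c, H7_u}, {H7_u, H7_d}, {H7_d, H7_b}})"

datatype h15 = InA h7 | InB h7 | Z

definition H15 :: "h15 graph" where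
  "H15 = (UNIV,
     (`) InA ` edges H7 \<union> (`) InB ` edges H7 \<union>
     {{InA H7_v, InB H7_v}, {InA H7_w, Z}, {Z, InB H7_w}})"

definition att_u :: h15 where "att_u = Z"
definition att_v :: h15 where "att_v = InB H7_u"
definition att_w :: h15 where "att_w = InA H7_u"


section \<open>The replacement of a cubic graph\<close>

definition orientation :: "'a graph \<Rightarrow> ('a \<Rightarrow> 'a set) \<Rightarrow> bool" where
  "orientation G \<omega> \<longleftrightarrow> (\<forall>x\<in>verts G. \<omega> x \<in> incident G x)"

text \<open>An orientation fixes only which edge at each vertex goes to \<open>att_u\<close>. The assignments below are
  all the choices of bijections compatible with it; they differ in how the two remaining edges
  at each vertex are distributed over \<open>att_v\<close> and \<open>att_w\<close>.\<close>

definition assignment :: "'a graph \<Rightarrow> ('a \<Rightarrow> 'a set) \<Rightarrow> ('a \<Rightarrow> 'a set \<Rightarrow> h15) \<Rightarrow> bool" where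
  "assignment G \<omega> \<phi> \<longleftrightarrow>
     (\<forall>x\<in>verts G. bij_betw (\<phi> x) (incident G x) {att_u, att_v, att_w} \<and> \<phi> x (\<omega> x) = att_u)"

text \<open>The vertex \<open>(x, p)\<close> is the vertex \<open>p\<close> in the copy of \<open>H15\<close> that replaces \<open>x\<close>.\<close>

definition replacement :: "'a graph \<Rightarrow> ('a \<Rightarrow> 'a set \<Rightarrow> h15) \<Rightarrow> ('a \<times> h15) graph" where
  "replacement G \<phi> =
     (verts G \<times> verts H15,
      {{(x, p), (x, q)} | x p q. x \<in> verts G \<and> {p, q} \<in> edges H15} \<union>
      {{(x, \<phi> x {x, y}), (y, \<phi> y {x, y})} | x y. {x, y} \<in> edges G})"

end

theory Submission imports Defs begin

text \<open>Lifting an \<open>\<ell>\<close>-cycle \<open>C\<close> of \<open>B\<close> to the replacement means choosing, in the gadget of each vertex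
  of \<open>C\<close>, a path between two attachments. Such a path can have any number of vertices from 4 to 15 if
  one of its ends is \<open>att_u\<close>, and any number from 6 to 15 otherwise. So if \<open>C\<close> contains the edges
  \<open>\<omega> x\<close> of at least \<open>k\<close> of its vertices \<open>x\<close>, its lifts realise all lengths from \<open>6 \<ell> - 2 k\<close> to
  \<open>15 \<ell>\<close>; this includes 64 once \<open>k \<ge> 3 \<ell> - 32\<close>. Counting the pairs of a vertex \<open>x\<close> and a
  cycle through \<open>\<omega> x\<close> in two ways shows that the hypothesis forces such a cycle.\<close>

text \<open>The parameter \<open>n\<close> counts vertices, not edges, so it adds up under
  concatenation and becomes the length of the cycle once the paths are joined in a ring.\<close>

definition path_betw :: "'a graph \<Rightarrow> 'a \<Rightarrow> 'a \<Rightarrow> nat \<Rightarrow> 'a list \<Rightarrow> bool" where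
  "path_betw G s t n q \<longleftrightarrow> q \<noteq> [] \<and> hd q = s \<and> last q = t \<and> length q = n \<and> distinct q
     \<and> successively (\<lambda>x y. {x, y} \<in> edges G) q"

lemma path_betw_rev:
  assumes "path_betw G s t n q"
  shows "path_betw G t s n (rev q)"
  using assms by (auto simp: path_betw_def hd_rev last_rev successively_rev insert_commute)

lemma path_betw_map:
  assumes "path_betw G s t n q" "inj f" "\<And>e. e \<in> edges G \<Longrightarrow> f ` e \<in> edges H"
  shows "path_betw H (f s) (f t) n (map f q)"
proof -
  have "successively (\<lambda>x y. {f x, f y} \<in> edges H) q"
    using assms(1) by (auto simp: path_betw_def elim!: successively_mono dest: assms(3))
  with assms(1,2) show ?thesis
    by (auto simp: path_betw_def hd_map last_map successively_map distinct_map
        intro: inj_on_subset)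
qed

lemma path_betw_singleton: "path_betw G s s 1 [s]"
  by (simp add: path_betw_def)

lemma path_betw_append:
  assumes "path_betw G s t m q" "path_betw G s' t' n r" "{t, s'} \<in> edges G"
    and "set q \<inter> set r = {}"
  shows "path_betw G s t' (m + n) (q @ r)"
  using assms by (auto simp: path_betw_def successively_append_iff)

section \<open>Paths in the gadgets\<close>

lemma H7_path_uv:
  assumes "3 \<le> n" "n \<le> 7"
  shows "\<exists>q. path_betw H7 H7_u H7_v n q"
proof -
  have "path_betw H7 H7_u H7_v 3 [H7_u, H7_c, H7_v]"
    "path_betw H7 H7_u H7_v 4 [H7_u, H7_c, H7_a, H7_v]"
    "path_betw H7 H7_u H7_v 5 [H7_u, H7_d, H7_b, H7_a, H7_v]"
    "path_betw H7 H7_u H7_v 6 [H7_u, H7_d, H7_b, H7_a, H7_c, H7_v]"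
    "path_betw H7 H7_u H7_v 7 [H7_u, H7_d, H7_w, H7_b, H7_a, H7_c, H7_v]"
    by (simp_all add: path_betw_def H7_def doubleton_eq_iff)
  moreover have "n = 3 \<or> n = 4 \<or> n = 5 \<or> n = 6 \<or> n = 7" using assms by linarith
  ultimately show ?thesis by blast
qed

text \<open>The automorphism of \<open>H7\<close> that fixes \<open>H7_u\<close> and exchanges v
  with w, a with b and c with d turns the paths of the previous lemma into these.\<close>

lemma H7_path_uw:
  assumes "3 \<le> n" "n \<le> 7"
  shows "\<exists>q. path_betw H7 H7_u H7_w n q"
proof -
  have "path_betw H7 H7_u H7_w 3 [H7_u, H7_d, H7_w]"
    "path_betw H7 H7_u H7_w 4 [H7_u, H7_d, H7_b, H7_w]"
    "path_betw H7 H7_u H7_w 5 [H7_u, H7_c, H7_a, H7_b, H7_w]"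
    "path_betw H7 H7_u H7_w 6 [H7_u, H7_c, H7_a, H7_b, H7_d, H7_w]"
    "path_betw H7 H7_u H7_w 7 [H7_u, H7_c, H7_v, H7_a, H7_b, H7_d, H7_w]"
    by (simp_all add: path_betw_def H7_def doubleton_eq_iff)
  moreover have "n = 3 \<or> n = 4 \<or> n = 5 \<or> n = 6 \<or> n = 7" using assms by linarith
  ultimately show ?thesis by blast
qed

text \<open>The range starts at 4 because \<open>H7_w\<close> and \<open>H7_v\<close> have no common
  neighbour.\<close>

lemma H7_path_wv:
  assumes "4 \<le> n" "n \<le> 7"
  shows "\<exists>q. path_betw H7 H7_w H7_v n q"
proof -
  have "path_betw H7 H7_w H7_v 4 [H7_w, H7_b, H7_a, H7_v]"
    "path_betw H7 H7_w H7_v 5 [H7_w, H7_d, H7_b, H7_a, H7_v]"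
    "path_betw H7 H7_w H7_v 6 [H7_w, H7_d, H7_b, H7_a, H7_c, H7_v]"
    "path_betw H7 H7_w H7_v 7 [H7_w, H7_b, H7_d, H7_u, H7_c, H7_a, H7_v]"
    by (simp_all add: path_betw_def H7_def doubleton_eq_iff)
  moreover have "n = 4 \<or> n = 5 \<or> n = 6 \<or> n = 7" using assms by linarith
  ultimately show ?thesis by blast
qed

lemma H15_path_InA:
  assumes "path_betw H7 s t n q"
  shows "path_betw H15 (InA s) (InA t) n (map InA q)"
  using assms by (rule path_betw_map) (auto simp: H15_def inj_def)

lemma H15_path_InB:
  assumes "path_betw H7 s t n q"
  shows "path_betw H15 (InB s) (InB t) n (map InB q)"
  using assms by (rule path_betw_map) (auto simp: H15_def inj_def)

lemma H15_connecting_edges: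
  "{InA H7_v, InB H7_v} \<in> edges H15" "{InB H7_v, InA H7_v} \<in> edges H15"
  "{InA H7_w, Z} \<in> edges H15" "{Z, InA H7_w} \<in> edges H15"
  "{InB H7_w, Z} \<in> edges H15" "{Z, InB H7_w} \<in> edges H15"
  by (auto simp: H15_def)

text \<open>Distributes a prescribed total over two pieces of bounded size: the first piece stays at
  its minimum \<open>a\<close> as long as the second can take the rest; beyond that the second is at
  its maximum \<open>b'\<close>.\<close>

lemma split_between:
  fixes n :: nat
  assumes "a + b \<le> n" "n \<le> a' + b'" "a \<le> a'" "b \<le> b'"
  obtains i j where "n = i + j" "a \<le> i" "i \<le> a'" "b \<le> j" "j \<le> b'"
proof (cases "n \<le> a + b'")
  case True
  then show ?thesis using assms that[of a "n - a"] by simp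
next
  case False
  then show ?thesis using assms that[of "n - b'" b'] by simp
qed

lemma H15_path_uv:
  assumes "4 \<le> n" "n \<le> 15"
  shows "\<exists>q. path_betw H15 att_u att_v n q"
proof (cases "n \<le> 8")
  \<comment> \<open>Short paths go from \<open>Z\<close> straight into copy B at
    \<open>InB H7_w\<close> and cover 1 + (3..7) = 4..8 vertices.\<close>
  case True
  with assms obtain q where q: "path_betw H7 H7_u H7_w (n - 1) q"
    using H7_path_uw[of "n - 1"] by fastforce
  have "path_betw H15 Z (InB H7_u) (1 + (n - 1)) ([Z] @ map InB (rev q))"
    by (rule path_betw_append[OF path_betw_singleton H15_path_InB[OF path_betw_rev[OF q]]])
      (auto simp: H15_connecting_edges)
  with assms show ?thesis by (auto simp: att_u_def att_v_def)
next
  \<comment> \<open>Long paths make the detour through copy A, from \<open>InA H7_w\<close> to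
    \<open>InA H7_v\<close>, and enter B at \<open>InB H7_v\<close>: 1 + (4..7) + (3..7) = 8..15
    vertices.\<close>
  case False
  then have "4 + 3 \<le> n - 1" "n - 1 \<le> 7 + 7" using assms by simp_all
  then obtain i j where ij: "n - 1 = i + j" "4 \<le> i" "i \<le> 7" "3 \<le> j" "j \<le> 7"
    by (rule split_between) simp_all
  obtain q r where q: "path_betw H7 H7_w H7_v i q" and r: "path_betw H7 H7_u H7_v j r"
    using H7_path_wv[of i] H7_path_uv[of j] ij by auto
  have "path_betw H15 (InA H7_w) (InB H7_u) (i + j) (map InA q @ map InB (rev r))"
    by (rule path_betw_append[OF H15_path_InA[OF q] H15_path_InB[OF path_betw_rev[OF r]]])
      (auto simp: H15_connecting_edges)
  then have "path_betw H15 Z (InB H7_u) (1 + (i + j)) ([Z] @ map InA q @ map InB (rev r))"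
    by (rule path_betw_append[OF path_betw_singleton]) (auto simp: H15_connecting_edges)
  moreover have "1 + (i + j) = n" using ij False by simp
  ultimately show ?thesis by (auto simp: att_u_def att_v_def)
qed

text \<open>The mirror image of \<open>H15_path_uv\<close> under exchanging the copies A and B,
  which fixes \<open>Z\<close>.\<close>

lemma H15_path_uw:
  assumes "4 \<le> n" "n \<le> 15"
  shows "\<exists>q. path_betw H15 att_u att_w n q"
proof (cases "n \<le> 8")
  case True
  with assms obtain q where q: "path_betw H7 H7_u H7_w (n - 1) q"
    using H7_path_uw[of "n - 1"] by fastforce
  have "path_betw H15 Z (InA H7_u) (1 + (n - 1)) ([Z] @ map InA (rev q))"
    by (rule path_betw_append[OF path_betw_singleton H15_path_InA[OF path_betw_rev[OF q]]])
      (auto simp: H15_connecting_edges)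
  with assms show ?thesis by (auto simp: att_u_def att_w_def)
next
  case False
  then have "4 + 3 \<le> n - 1" "n - 1 \<le> 7 + 7" using assms by simp_all
  then obtain i j where ij: "n - 1 = i + j" "4 \<le> i" "i \<le> 7" "3 \<le> j" "j \<le> 7"
    by (rule split_between) simp_all
  obtain q r where q: "path_betw H7 H7_w H7_v i q" and r: "path_betw H7 H7_u H7_v j r"
    using H7_path_wv[of i] H7_path_uv[of j] ij by auto
  have "path_betw H15 (InB H7_w) (InA H7_u) (i + j) (map InB q @ map InA (rev r))"
    by (rule path_betw_append[OF H15_path_InB[OF q] H15_path_InA[OF path_betw_rev[OF r]]])
      (auto simp: H15_connecting_edges)
  then have "path_betw H15 Z (InA H7_u) (1 + (i + j)) ([Z] @ map InB q @ map InA (rev r))"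
    by (rule path_betw_append[OF path_betw_singleton]) (auto simp: H15_connecting_edges)
  moreover have "1 + (i + j) = n" using ij False by simp
  ultimately show ?thesis by (auto simp: att_u_def att_w_def)
qed

lemma H15_path_wv:
  assumes "6 \<le> n" "n \<le> 15"
  shows "\<exists>q. path_betw H15 att_w att_v n q"
proof (cases "n \<le> 14")
  \<comment> \<open>Crossing along the edge between \<open>InA H7_v\<close> and
    \<open>InB H7_v\<close> misses \<open>Z\<close>, so it gives (3..7) + (3..7) = 6..14
    vertices.\<close>
  case True
  with assms obtain i j where ij: "n = i + j" "3 \<le> i" "i \<le> 7" "3 \<le> j" "j \<le> 7"
    using split_between[of 3 3 n 7 7] by auto
  obtain q r where q: "path_betw H7 H7_u H7_v i q" and r: "path_betw H7 H7_u H7_v j r"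
    using H7_path_uv[of i] H7_path_uv[of j] ij by auto
  have "path_betw H15 (InA H7_u) (InB H7_u) (i + j) (map InA q @ map InB (rev r))"
    by (rule path_betw_append[OF H15_path_InA[OF q] H15_path_InB[OF path_betw_rev[OF r]]])
      (auto simp: H15_connecting_edges)
  with ij show ?thesis by (auto simp: att_w_def att_v_def)
next
  \<comment> \<open>Only 15 is left: a Hamiltonian path, which has to use \<open>Z\<close> and
    therefore crosses between the copies through it.\<close>
  case False
  obtain q where q: "path_betw H7 H7_u H7_w 7 q"
    using H7_path_uw[of 7] by auto
  have "path_betw H15 Z (InB H7_u) (1 + 7) ([Z] @ map InB (rev q))"
    by (rule path_betw_append[OF path_betw_singleton H15_path_InB[OF path_betw_rev[OF q]]])
      (auto simp: H15_connecting_edges)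
  then have "path_betw H15 (InA H7_u) (InB H7_u) (7 + (1 + 7)) (map InA q @ [Z] @ map InB (rev q))"
    by (rule path_betw_append[OF H15_path_InA[OF q]]) (auto simp: H15_connecting_edges)
  moreover have "n = 7 + (1 + 7)" using False assms by simp
  ultimately show ?thesis by (auto simp: att_w_def att_v_def)
qed

lemma H15_path:
  assumes st: "s \<in> {att_u, att_v, att_w}" "t \<in> {att_u, att_v, att_w}" "s \<noteq> t"
    and n: "(if att_u \<in> {s, t} then 4 else 6) \<le> n" "n \<le> 15"
  shows "\<exists>q. path_betw H15 s t n q"
proof -
  consider "s = att_u" "t = att_v" | "s = att_u" "t = att_w" | "s = att_w" "t = att_v"
    | "s = att_v" "t = att_u" | "s = att_w" "t = att_u" | "s = att_v" "t = att_w"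
    using st by blast
  moreover have "4 \<le> n" using n(1) by (simp split: if_splits)
  moreover have "6 \<le> n" if "att_u \<notin> {s, t}" using n(1) that by simp
  moreover have "att_u \<noteq> att_v" "att_u \<noteq> att_w" by (simp_all add: att_u_def att_v_def att_w_def)
  ultimately show ?thesis
    using n(2) H15_path_uv[of n] H15_path_uw[of n] H15_path_wv[of n]
    by cases (auto dest: path_betw_rev)
qed

section \<open>Lifting cycles to the replacement\<close>

lemma successively_concat:
  assumes "\<And>q. q \<in> set qs \<Longrightarrow> q \<noteq> [] \<and> successively R q"
    and "successively (\<lambda>q r. R (last q) (hd r)) qs"
  shows "successively R (concat qs)"
  using assms
proof (induction qs)
  case (Cons q qs)
  then have "successively R (concat qs)" by (auto simp: successively_Cons)
  moreover have "R (last q) (hd (concat qs))" if "concat qs \<noteq> []"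
    using Cons.prems that by (cases qs) (auto simp: hd_append)
  ultimately show ?case using Cons.prems by (auto simp: successively_append_iff)
qed simp

lemma is_cycle_of_closed_path:
  assumes "3 \<le> length p" "distinct p" "set p \<subseteq> verts G"
    and "successively (\<lambda>x y. {x, y} \<in> edges G) p" "{last p, hd p} \<in> edges G"
  shows "cycles G (length p) \<noteq> {}"
proof -
  let ?C = "(set p, {{p ! i, p ! (Suc i mod length p)} | i. i < length p})"
  have "{p ! i, p ! (Suc i mod length p)} \<in> edges G" if i: "i < length p" for i
  proof (cases "Suc i < length p")
    case True
    then show ?thesis using assms(4) by (simp add: successively_conv_nth)
  next
    \<comment> \<open>At the last index the successor modulo the length wraps around to 0, which is
      the closing edge.\<close>
    case False
    with i have "Suc i = length p" by simp
    then have "i = length p - 1" "Suc i mod length p = 0" by simp_all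
    moreover have "p \<noteq> []" using i by auto
    ultimately show ?thesis using assms(5) by (simp add: last_conv_nth hd_conv_nth)
  qed
  then have "subgraph ?C G" using assms(3) by (auto simp: subgraph_def)
  moreover have "is_cycle (length p) ?C" using assms(1,2) by (auto simp: is_cycle_def)
  ultimately show ?thesis by (auto simp: cycles_def)
qed

text \<open>A discrete intermediate value property, by induction on \<open>A\<close>:
  \<open>split_between\<close> separates the share of the new element from a total that the
  remaining ones can still reach.\<close>

lemma sum_eq_between:
  fixes lo :: "'i \<Rightarrow> nat"
  assumes "finite A" "\<And>i. i \<in> A \<Longrightarrow> lo i \<le> M" "sum lo A \<le> N" "N \<le> M * card A"
  shows "\<exists>n. (\<forall>i\<in>A. lo i \<le> n i \<and> n i \<le> M) \<and> sum n A = N"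
  using assms
proof (induction A arbitrary: N rule: finite_induct)
  case (insert a A)
  have "sum lo A \<le> M * card A"
    using sum_bounded_above[of A lo M] insert.prems by (simp add: mult.commute)
  then obtain i j where ij: "N = i + j" "lo a \<le> i" "i \<le> M" "sum lo A \<le> j" "j \<le> M * card A"
    using split_between[of "lo a" "sum lo A" N M "M * card A"] insert by auto
  obtain n where "\<forall>i\<in>A. lo i \<le> n i \<and> n i \<le> M" "sum n A = j"
    using insert.IH[of j] insert.prems ij by auto
  moreover from this have "sum (n(a := i)) (insert a A) = N"
    using ij insert.hyps by (auto intro!: sum.cong)
  ultimately show ?case
    using ij by (intro exI[of _ "n(a := i)"]) auto
qed auto

lemma replacement_copy_edge:
  assumes "x \<in> verts G" "{p, q} \<in> edges H15"
  shows "{(x, p), (x, q)} \<in> edges (replacement G \<phi>)"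
  using assms by (auto simp: replacement_def)

lemma replacement_cross_edge:
  assumes "{x, y} \<in> edges G"
  shows "{(x, \<phi> x {x, y}), (y, \<phi> y {x, y})} \<in> edges (replacement G \<phi>)"
  using assms by (auto simp: replacement_def)

text \<open>Each vertex of \<open>C\<close> needs at least 6 vertices of its gadget, or 4 if
  \<open>C\<close> uses its edge \<open>\<omega> x\<close>. The lower bound on \<open>N\<close> is
  written additively to avoid truncated subtraction.\<close>

lemma cycle_lifts:
  assumes G: "simple_graph G" and om: "orientation G \<omega>" and as: "assignment G \<omega> \<phi>"
    and C: "C \<in> cycles G l"
    and N: "6 * l \<le> N + 2 * card {x \<in> verts G. \<omega> x \<in> edges C}" "N \<le> 15 * l"
  shows "cycles (replacement G \<phi>) N \<noteq> {}"
proof -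
  from C obtain p where l3: "3 \<le> l" and p: "distinct p" "length p = l"
    and Cp: "C = (set p, {{p ! i, p ! (Suc i mod l)} | i. i < l})"
    and sub: "set p \<subseteq> verts G" "edges C \<subseteq> edges G"
    by (auto simp: cycles_def is_cycle_def subgraph_def)
  \<comment> \<open>Positions on the cycle are taken modulo \<open>l\<close>; \<open>pr\<close> adds
    \<open>l - 1\<close> because subtracting 1 would truncate at 0. The edge \<open>e i\<close>
    leaves position \<open>i\<close>, and \<open>e (pr i)\<close> enters it.\<close>
  define nx where "nx i = Suc i mod l" for i
  define pr where "pr i = (i + (l - 1)) mod l" for i
  define e where "e i = {p ! i, p ! nx i}" for i
  have nx: "nx i < l" "nx i = (if Suc i = l then 0 else Suc i)" if "i < l" for i
    using that by (auto simp: nx_def)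
  have pr: "pr i = (if i = 0 then l - 1 else i - 1)" if "i < l" for i
  proof (cases "i = 0")
    case False
    then have "i + (l - 1) = l + (i - 1)" using l3 by simp
    then have "pr i = (i - 1) mod l" by (simp only: pr_def mod_add_self1)
    then show ?thesis using that False by simp
  qed (use l3 in \<open>simp add: pr_def\<close>)
  have pr_less: "pr i < l" and nx_pr: "nx (pr i) = i" and pr_nx: "pr (nx i) = i"
    and pr_ne: "pr i \<noteq> i" and nx_ne: "nx i \<noteq> pr i" if "i < l" for i
    using that l3 nx[of i] nx[of "pr i"] pr[of i] pr[of "nx i"] by (auto split: if_splits)
  have edges_C: "edges C = e ` {..<l}"
    by (auto simp: Cp e_def nx_def)
  have e_in: "e i \<in> edges G" if "i < l" for i
    using sub(2) that by (auto simp: edges_C)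
  have inc: "e i \<in> incident G (p ! i)" "e (pr i) \<in> incident G (p ! i)" if "i < l" for i
    using that e_in[of i] e_in[of "pr i"] pr_less[of i] nx_pr[of i]
    by (auto simp: incident_def e_def)
  have pi: "p ! i \<in> verts G" if "i < l" for i
    using sub(1) p that nth_mem by blast
  have nth_eq: "p ! i = p ! j \<longleftrightarrow> i = j" if "i < l" "j < l" for i j
    using p that nth_eq_iff_index_eq by blast
  \<comment> \<open>Since \<open>l\<close> is at least 3, predecessor and successor differ. Hence
    the two cycle edges at a vertex are distinct and get distinct attachments.\<close>
  have e_ne: "e (pr i) \<noteq> e i" if "i < l" for i
    using that pr_less[of i] nx_pr[of i] nx(1)[of i] pr_ne[of i] nx_ne[of i]
    by (auto simp: e_def doubleton_eq_iff nth_eq)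
  have e_iff: "p ! i \<in> e j \<longleftrightarrow> j = i \<or> j = pr i" if "i < l" "j < l" for i j
    using that nx(1)[of j] nx_pr[of i] pr_nx[of j] by (auto simp: e_def nth_eq)
  have phi: "bij_betw (\<phi> x) (incident G x) {att_u, att_v, att_w}" "\<phi> x (\<omega> x) = att_u"
    "\<omega> x \<in> incident G x" if "x \<in> verts G" for x
    using om as that by (auto simp: orientation_def assignment_def)

  define lo :: "nat \<Rightarrow> nat" where "lo i = (if \<omega> (p ! i) \<in> edges C then 4 else 6)" for i
  define K where "K = {i \<in> {..<l}. \<omega> (p ! i) \<in> edges C}"
  \<comment> \<open>As \<open>x\<close> is an end of \<open>\<omega> x\<close>, any \<open>x\<close>
    counted here lies on the cycle, so it can be counted by its position.\<close>
  have "{x \<in> verts G. \<omega> x \<in> edges C} \<subseteq> (\<lambda>i. p ! i) ` K"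
  proof
    fix x assume "x \<in> {x \<in> verts G. \<omega> x \<in> edges C}"
    then have x: "x \<in> verts G" "\<omega> x \<in> edges C" by auto
    then obtain j where j: "j < l" "\<omega> x = e j" by (auto simp: edges_C)
    moreover have "x \<in> \<omega> x" using phi(3) x by (auto simp: incident_def)
    ultimately have "\<exists>i<l. x = p ! i" using nx(1) by (auto simp: e_def)
    then show "x \<in> (\<lambda>i. p ! i) ` K" using x by (auto simp: K_def)
  qed
  then have "card {x \<in> verts G. \<omega> x \<in> edges C} \<le> card K"
    by (rule surj_card_le[rotated]) (simp add: K_def)
  moreover have "sum lo {..<l} + 2 * card K = 6 * l"
  proof -
    have "sum lo {..<l} + 2 * card K = (\<Sum>i<l. lo i + (if i \<in> K then 2 else 0))"
      by (simp add: sum.distrib sum.If_cases K_def Int_def)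
    also have "\<dots> = (\<Sum>i<l. 6)"
      by (rule sum.cong) (auto simp: lo_def K_def)
    finally show ?thesis by simp
  qed
  ultimately have "sum lo {..<l} \<le> N" using N(1) by linarith
  moreover have lo_le: "lo i \<le> 15" for i by (simp add: lo_def)
  ultimately obtain n where n: "\<And>i. i < l \<Longrightarrow> lo i \<le> n i \<and> n i \<le> 15" "sum n {..<l} = N"
    using sum_eq_between[of "{..<l}" lo 15 N] N(2)
    by (metis (no_types, lifting) card_lessThan finite_lessThan lessThan_iff lo_le)

  \<comment> \<open>The copy of \<open>p ! i\<close> is traversed from the attachment of the
    entering edge to that of the leaving edge.\<close>
  have "\<exists>q. path_betw H15 (\<phi> (p ! i) (e (pr i))) (\<phi> (p ! i) (e i)) (n i) q" if i: "i < l" for i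
  proof (rule H15_path)
    note bij = phi(1)[OF pi[OF i]]
    show "\<phi> (p ! i) (e (pr i)) \<in> {att_u, att_v, att_w}" "\<phi> (p ! i) (e i) \<in> {att_u, att_v, att_w}"
      using bij inc[OF i] by (meson bij_betwE)+
    show "\<phi> (p ! i) (e (pr i)) \<noteq> \<phi> (p ! i) (e i)"
      using bij inc[OF i] e_ne[OF i] by (meson bij_betw_imp_inj_on inj_onD)
    \<comment> \<open>A cycle edge containing \<open>p ! i\<close> is the entering or the leaving
      one; so if \<open>\<omega> (p ! i)\<close> is on the cycle, its attachment
      \<open>att_u\<close> is an end of the path.\<close>
    have "att_u \<in> {\<phi> (p ! i) (e (pr i)), \<phi> (p ! i) (e i)}" if om: "\<omega> (p ! i) \<in> edges C"
    proof -
      obtain j where "j < l" "\<omega> (p ! i) = e j" using om by (auto simp: edges_C)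
      moreover have "p ! i \<in> \<omega> (p ! i)" using phi(3)[OF pi[OF i]] by (auto simp: incident_def)
      ultimately have "\<omega> (p ! i) \<in> {e (pr i), e i}" using e_iff[OF i] by auto
      then show ?thesis using phi(2)[OF pi[OF i]] by auto
    qed
    then show "(if att_u \<in> {\<phi> (p ! i) (e (pr i)), \<phi> (p ! i) (e i)} then 4 else 6) \<le> n i"
      using n(1)[OF i] by (auto simp: lo_def split: if_splits)
    show "n i \<le> 15" using n(1)[OF i] by simp
  qed
  then obtain Q where
    Q: "\<And>i. i < l \<Longrightarrow> path_betw H15 (\<phi> (p ! i) (e (pr i))) (\<phi> (p ! i) (e i)) (n i) (Q i)"
    by metis

  define R where "R i = map (Pair (p ! i)) (Q i)" for i
  let ?adj = "\<lambda>x y. {x, y} \<in> edges (replacement G \<phi>)"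
  have R: "R i \<noteq> []" "hd (R i) = (p ! i, \<phi> (p ! i) (e (pr i)))"
    "last (R i) = (p ! i, \<phi> (p ! i) (e i))" "length (R i) = n i" "distinct (R i)"
    "successively ?adj (R i)" if i: "i < l" for i
  proof -
    show "successively ?adj (R i)"
      unfolding R_def successively_map
      by (rule successively_mono[of "\<lambda>x y. {x, y} \<in> edges H15"])
        (use Q[OF i] pi[OF i] in \<open>auto simp: path_betw_def intro: replacement_copy_edge\<close>)
  qed (use Q[OF i] in \<open>auto simp: R_def path_betw_def hd_map last_map distinct_map inj_on_def\<close>)
  \<comment> \<open>The edge \<open>e i\<close> leaves position \<open>i\<close> and enters
    \<open>nx i\<close>, so its replacement joins the end of one block to the start of the
    next.\<close>
  have step: "?adj (last (R i)) (hd (R (nx i)))" if "i < l" for i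
    using replacement_cross_edge[of "p ! i" "p ! nx i" G \<phi>] e_in[OF that]
    by (simp add: R that nx(1) pr_nx e_def)

  define S where "S = concat (map R [0..<l])"
  have "length S = N"
    using n(2) by (simp add: S_def length_concat comp_def R(4) sum_list_distinct_conv_sum_set
        interv_sum_list_conv_sum_set_nat lessThan_atLeast0)
  moreover have "distinct S"
  proof -
    have disj: "set (R i) \<inter> set (R j) = {}" if "i < l" "j < l" "i \<noteq> j" for i j
      using that by (auto simp: R_def nth_eq)
    \<comment> \<open>Blocks lie in different copies, and two disjoint nonempty blocks cannot be
      equal; \<open>distinct_concat\<close> asks for a list of distinct blocks.\<close>
    then have inj: "inj_on R {0..<l}"
      using R(1) by (intro inj_onI) (metis Int_absorb atLeastLessThan_iff set_empty)
    show ?thesis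
      unfolding S_def
    proof (rule distinct_concat)
      show "distinct (map R [0..<l])" using inj by (simp add: distinct_map)
      show "distinct q" if "q \<in> set (map R [0..<l])" for q using that R(5) by auto
      show "set q \<inter> set r = {}" if "q \<in> set (map R [0..<l])" "r \<in> set (map R [0..<l])" "q \<noteq> r"
        for q r
      proof -
        from that obtain i j where "i < l" "j < l" "q = R i" "r = R j" by auto
        with that(3) show ?thesis using disj[of i j] by blast
      qed
    qed
  qed
  moreover have "successively ?adj S"
    unfolding S_def
  proof (rule successively_concat)
    have "?adj (last (R i)) (hd (R (Suc i)))" if "Suc i < l" for i
      using step[of i] nx(2)[of i] that by simp
    then show "successively (\<lambda>q r. ?adj (last q) (hd r)) (map R [0..<l])"
      by (simp add: successively_conv_nth)
  qed (use R in auto)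
  moreover have "set S \<subseteq> verts (replacement G \<phi>)"
    using pi by (auto simp: S_def R_def replacement_def H15_def)
  moreover have "?adj (last S) (hd S)"
  proof -
    have "[0..<l] = 0 # [1..<l]" using l3 by (simp add: upt_conv_Cons)
    then have "hd S = hd (R 0)" using R(1)[of 0] l3 by (simp add: S_def)
    moreover have "[0..<l] = [0..<l - 1] @ [l - 1]" using l3 upt_Suc_append[of 0 "l - 1"] by simp
    then have "last S = last (R (l - 1))" using R(1)[of "l - 1"] l3 by (simp add: S_def)
    moreover have "nx (l - 1) = 0" using l3 by (simp add: nx_def)
    ultimately show ?thesis using step[of "l - 1"] l3 by simp
  qed
  moreover have "3 \<le> N"
  proof -
    have "1 \<le> n i" if "i < l" for i using R(1)[OF that] R(4)[OF that] by (cases "R i") auto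
    then have "(\<Sum>i<l. 1) \<le> (\<Sum>i<l. n i)" by (intro sum_mono) simp
    then show ?thesis using l3 n(2) by simp
  qed
  ultimately show ?thesis using is_cycle_of_closed_path[of S "replacement G \<phi>"] by simp
qed

section \<open>Counting\<close>

lemma finite_cycles:
  assumes "simple_graph G"
  shows "finite (cycles G l)"
proof (rule finite_subset)
  show "cycles G l \<subseteq> Pow (verts G) \<times> Pow (edges G)"
    by (auto simp: cycles_def subgraph_def)
  have "finite (verts G)" "edges G \<subseteq> Pow (verts G)" using assms by (auto simp: simple_graph_def)
  then show "finite (Pow (verts G) \<times> Pow (edges G))"
    by (meson finite_Pow_iff finite_SigmaI finite_subset)
qed

lemma c_min_le:
  assumes "cubic_graph G" "x \<in> verts G" "e \<in> incident G x"
  shows "c_min G l x \<le> num_cycles_through G l e"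
proof -
  have "card (incident G x) = 3" using assms(1,2) by (simp add: cubic_graph_def)
  \<comment> \<open>An infinite set would have cardinality 0; finiteness makes \<open>Min\<close> a
    lower bound.\<close>
  then have "finite (incident G x)" by (intro card_ge_0_finite) simp
  then show ?thesis using assms(3) by (simp add: c_min_def)
qed

lemma ex_cycle_many_oriented:
  assumes G: "cubic_graph G" and om: "orientation G \<omega>"
    and less: "k * num_cycles G l < (\<Sum>x\<in>verts G. c_min G l x)"
  shows "\<exists>C\<in>cycles G l. k < card {x \<in> verts G. \<omega> x \<in> edges C}"
proof (rule ccontr)
  assume "\<not> ?thesis"
  then have le: "card {x \<in> verts G. \<omega> x \<in> edges C} \<le> k" if "C \<in> cycles G l" for C
    using that by (auto simp: not_less)
  have fin: "finite (verts G)" "finite (cycles G l)"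
    using G finite_cycles[of G l] by (auto simp: cubic_graph_def simple_graph_def)
  \<comment> \<open>The minimum bounds the count for \<open>\<omega> x\<close> whichever of the
    three edges the orientation picks, so the argument covers all orientations at once.\<close>
  have "(\<Sum>x\<in>verts G. c_min G l x) \<le> (\<Sum>x\<in>verts G. num_cycles_through G l (\<omega> x))"
    using om by (intro sum_mono c_min_le G) (auto simp: orientation_def)
  also have "\<dots> = (\<Sum>x\<in>verts G. card {C \<in> cycles G l. \<omega> x \<in> edges C})"
    by (simp add: num_cycles_through_def)
  also have "\<dots> = (\<Sum>C\<in>cycles G l. card {x \<in> verts G. \<omega> x \<in> edges C})"
    by (rule sum_multicount_gen) (use fin in auto)
  also have "\<dots> \<le> (\<Sum>C\<in>cycles G l. k)" by (rule sum_mono) (rule le)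
  also have "\<dots> = k * num_cycles G l" by (simp add: num_cycles_def)
  finally show False using less by simp
qed

theorem lemma5p2:
  fixes B :: "'a graph"
  assumes "cubic_graph B"
    and "\<exists>l\<in>{13, 14, 15, 16}. (\<Sum>x\<in>verts B. c_min B l x) > (3 * l - 33) * num_cycles B l"
  shows "\<forall>\<omega> \<phi>. orientation B \<omega> \<and> assignment B \<omega> \<phi> \<longrightarrow> cycles (replacement B \<phi>) 64 \<noteq> {}"
proof (intro allI impI, elim conjE)
  fix \<omega> \<phi> assume om: "orientation B \<omega>" and as: "assignment B \<omega> \<phi>"
  obtain l where l: "l \<in> {13, 14, 15, 16}"
    and less: "(3 * l - 33) * num_cycles B l < (\<Sum>x\<in>verts B. c_min B l x)"
    using assms(2) by blast
  \<comment> \<open>The strict inequality means at least \<open>3 * l - 32\<close> vertices with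
    \<open>\<omega> x\<close> on \<open>C\<close>, and 64 + 2 (3 l - 32) = 6 l is exactly the lower
    bound that \<open>cycle_lifts\<close> requires.\<close>
  obtain C where C: "C \<in> cycles B l" "3 * l - 33 < card {x \<in> verts B. \<omega> x \<in> edges C}"
    using ex_cycle_many_oriented[OF assms(1) om less] by blast
  show "cycles (replacement B \<phi>) 64 \<noteq> {}"
  proof (rule cycle_lifts[OF _ om as C(1)])
    show "simple_graph B" using assms(1) by (simp add: cubic_graph_def)
    show "6 * l \<le> 64 + 2 * card {x \<in> verts B. \<omega> x \<in> edges C}" "64 \<le> 15 * l"
      using l C(2) by auto
  qed
qed

end
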